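(* For all integers $i,k$ with $2\le i\le k-1$, the patterns $12\cdots k$ and $12\cdots(i-1)(i+1)\cdots k\,i$ in $\mathcal S_k$ form a tied pair: $$12\cdots k\equiv 12\cdots(i-1)(i+1)\cdots k\,i .$$
   Context: $\mathcal S_k$ is the set of permutations of $\{1,\dots,k\}$ in one-line notation. For a sequence of distinct reals, $\mathrm{st}$ replaces the smallest entry by $1$, the second smallest by $2$, etc. Let $X_1,X_2,\dots$ be i.i.d. continuous random variables (e.g. uniform on $[0,1]$). A consecutive occurrence of $\sigma\in\mathcal S_k$ is a block $X_i,\dots,X_{i+k-1}$ with $\mathrm{st}(X_i\dots X_{i+k-1})=\sigma$. For distinct $\sigma,\tau\in\mathcal S_k$, $\Pr(\sigma\prec\tau)$ is the probability that the first consecutive occurrence of $\sigma$ in the sequence appears before the first consecutive occurrence of $\tau$. We write $\sigma\equiv\tau$ ("tied pair") if $\Pr(\sigma\prec\tau)=\Pr(\tau\prec\sigma)=\frac12$. *)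

theory Defs
  imports "HOL-Probability.Probability" "HOL-Combinatorics.Multiset_Permutations"
begin

text \<open>Permutations of \<open>{1..k}\<close> are lists in one-line notation.\<close>

abbreviation perms :: "nat \<Rightarrow> nat list set" where
  "perms k \<equiv> permutations_of_set {1..k}"

text \<open>
  The smallest entry is replaced by 1, the second smallest by 2, and so on. A list with
  repeated entries is mapped to a list with repeated entries, hence never to a permutation.
\<close>

definition st :: "real list \<Rightarrow> nat list" where
  "st xs = map (\<lambda>x. card {y \<in> set xs. y \<le> x}) xs"

text \<open>Sequences are indexed from 0, so a block starting at \<open>n\<close> is \<open>x n, \<dots>, x (n + k - 1)\<close>.\<close>

definition occurs_at :: "nat list \<Rightarrow> (nat \<Rightarrow> real) \<Rightarrow> nat \<Rightarrow> bool" where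
  "occurs_at \<sigma> x n \<longleftrightarrow> st (map x [n..<n + length \<sigma>]) = \<sigma>"

text \<open>The infimum of the empty set is \<open>\<infinity>\<close>: this is the value if there is no occurrence.\<close>

definition first_occurrence :: "nat list \<Rightarrow> (nat \<Rightarrow> real) \<Rightarrow> enat" where
  "first_occurrence \<sigma> x = (INF n\<in>{n. occurs_at \<sigma> x n}. enat n)"

definition prob_before ::
    "'a measure \<Rightarrow> (nat \<Rightarrow> 'a \<Rightarrow> real) \<Rightarrow> nat list \<Rightarrow> nat list \<Rightarrow> real" where
  "prob_before M X \<sigma> \<tau> =
     measure M {\<omega> \<in> space M.
       first_occurrence \<sigma> (\<lambda>n. X n \<omega>) < first_occurrence \<tau> (\<lambda>n. X n \<omega>)}"

definition tied_pair ::
    "'a measure \<Rightarrow> (nat \<Rightarrow> 'a \<Rightarrow> real) \<Rightarrow> nat \<Rightarrow> nat list \<Rightarrow> nat list \<Rightarrow> bool" where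
  "tied_pair M X k \<sigma> \<tau> \<longleftrightarrow>
     \<sigma> \<in> perms k \<and> \<tau> \<in> perms k \<and> \<sigma> \<noteq> \<tau> \<and>
     prob_before M X \<sigma> \<tau> = 1 / 2 \<and> prob_before M X \<tau> \<sigma> = 1 / 2"

text \<open>
  A random variable is continuous if its cumulative distribution function is; a density
  is not required.
\<close>

definition iid_continuous :: "'a measure \<Rightarrow> (nat \<Rightarrow> 'a \<Rightarrow> real) \<Rightarrow> bool" where
  "iid_continuous M X \<longleftrightarrow>
     prob_space.indep_vars M (\<lambda>_. borel) X UNIV \<and>
     (\<forall>m n. distr M borel (X m) = distr M borel (X n)) \<and>
     (\<forall>n. continuous_on UNIV (cdf (distr M borel (X n))))"

end

theory Submission
  imports Defs
begin

text \<open>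
  Write \<open>\<sigma> = 12\<dots>k\<close> and let \<open>p\<close> be the other pattern. Up to its last entry \<open>p\<close> is increasing, and
  it starts with its least entry because \<open>i \<ge> 2\<close>. Both features matter.

  Consider the event that \<open>\<sigma>\<close> or \<open>p\<close> occurs at \<open>n\<close>. Either occurrence makes \<open>x n, \<dots>, x (n + k - 2)\<close>
  increase. If also \<open>x (n - 1) < x n\<close>, then \<open>\<sigma>\<close> occurs at \<open>n - 1\<close>, so \<open>n\<close> is not the first occurrence
  of either pattern. If not, then no occurrence at some \<open>m < n\<close> can reach beyond position \<open>n\<close>, since
  the step from \<open>n - 1\<close> to \<open>n\<close> would be among its ascents. Hence an occurrence at \<open>n\<close> is
  the first one of either pattern if and only if a condition on \<open>x 0, \<dots>, x n\<close> alone holds, and it is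
  the same condition for both patterns (\<open>no_earlier_iff_fresh_start\<close>).

  Given \<open>x 0, \<dots>, x n\<close>, the patterns \<open>\<sigma>\<close> and \<open>p\<close> occur at \<open>n\<close> when \<open>x (n + 1), \<dots>, x (n + k - 1)\<close> all
  exceed \<open>x n\<close> and come in one particular order. These \<open>k - 1\<close> variables are exchangeable, so the
  two orders are equally likely. Permuting them turns the event that \<open>\<sigma>\<close> wins the race at \<open>n\<close> into
  the event that \<open>p\<close> wins it at \<open>n\<close> (\<open>wins_at_rearrange\<close>). Summing over \<open>n\<close> shows that the two
  patterns are equally likely to come first (\<open>prob_before_sym\<close>).

  Continuity ensures that somebody wins. The distribution function takes all values strictly
  between 0 and 1, which gives \<open>k\<close> consecutive intervals of equal positive probability; each
  of the disjoint blocks of length \<open>k\<close> runs through them in increasing order with the same positive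
  probability, independently of the other blocks
  (\<open>increasing_occurs_almost_surely\<close>). So the two probabilities also add up to 1.
\<close>

section \<open>Occurrences as order isomorphisms\<close>

lemma length_perms: "p \<in> perms k \<Longrightarrow> length p = k"
  by (simp add: length_finite_permutations_of_set)

lemma nth_perms: "p \<in> perms k \<Longrightarrow> a < k \<Longrightarrow> 1 \<le> p ! a \<and> p ! a \<le> k"
  by (metis atLeastAtMost_iff length_perms nth_mem permutations_of_setD(1))

lemma increasing_in_perms: "[1..<k + 1] \<in> perms k"
  by (auto simp: permutations_of_set_def)

text \<open>
  The rank of an entry is the number of entries below or equal to it. Ranks reflect the order
  within a list, and a permutation of \<open>{1..k}\<close> is its own list of ranks. The right-hand side also rules
  out repeated entries in \<open>xs\<close>, since \<open>p\<close> has none.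
\<close>

lemma st_eq_iff_order_isomorphic:
  assumes p: "p \<in> perms k" and len: "length xs = k"
  shows "st xs = p \<longleftrightarrow> (\<forall>a<k. \<forall>b<k. xs ! a \<le> xs ! b \<longleftrightarrow> p ! a \<le> p ! b)"
proof
  have rank_le_iff: "card {y \<in> set xs. y \<le> u} \<le> card {y \<in> set xs. y \<le> v} \<longleftrightarrow> u \<le> v"
    if "u \<in> set xs" "v \<in> set xs" for u v
  proof (cases "u \<le> v")
    case True
    then show ?thesis by (auto intro!: card_mono)
  next
    case False
    then have "{y \<in> set xs. y \<le> v} \<subset> {y \<in> set xs. y \<le> u}" using that by auto
    then have "card {y \<in> set xs. y \<le> v} < card {y \<in> set xs. y \<le> u}"
      by (intro psubset_card_mono) auto
    with False show ?thesis by simp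
  qed
  assume "st xs = p"
  then show "\<forall>a<k. \<forall>b<k. xs ! a \<le> xs ! b \<longleftrightarrow> p ! a \<le> p ! b"
    using len rank_le_iff by (auto simp: st_def)
next
  assume iso: "\<forall>a<k. \<forall>b<k. xs ! a \<le> xs ! b \<longleftrightarrow> p ! a \<le> p ! b"
  have lenp: "length p = k" and setp: "set p = {1..k}" and distp: "distinct p"
    using p by (auto simp: length_perms permutations_of_setD)
  have inj: "inj_on ((!) xs) {..<k}"
  proof (rule inj_onI)
    fix a b assume ab: "a \<in> {..<k}" "b \<in> {..<k}" "xs ! a = xs ! b"
    then have "p ! a = p ! b" using iso by (metis antisym lessThan_iff order_refl)
    then show "a = b" using ab distp lenp by (simp add: nth_eq_iff_index_eq)
  qed
  show "st xs = p"
  proof (rule nth_equalityI)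
    show "length (st xs) = length p" using len lenp by (simp add: st_def)
    fix a assume "a < length (st xs)"
    then have a: "a < k" using len by (simp add: st_def)
    let ?B = "{b. b < k \<and> p ! b \<le> p ! a}"
    have "{y \<in> set xs. y \<le> xs ! a} = (!) xs ` ?B"
      using iso a len by (auto simp: in_set_conv_nth)
    then have "card {y \<in> set xs. y \<le> xs ! a} = card ?B"
      by (simp add: card_image inj_on_subset[OF inj] subset_eq)
    also have "\<dots> = card ((!) p ` ?B)"
      by (intro card_image[symmetric] inj_onI) (use distp lenp in \<open>auto simp: nth_eq_iff_index_eq\<close>)
    also have "(!) p ` ?B = {v \<in> set p. v \<le> p ! a}"
      using lenp by (auto simp: in_set_conv_nth)
    also have "\<dots> = {1..p ! a}" using setp nth_perms[OF p a] by auto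
    finally show "st xs ! a = p ! a" using a len by (simp add: st_def)
  qed
qed

lemma occurs_at_iff_order_isomorphic:
  assumes "p \<in> perms k"
  shows "occurs_at p x n \<longleftrightarrow> (\<forall>a<k. \<forall>b<k. x (n + a) \<le> x (n + b) \<longleftrightarrow> p ! a \<le> p ! b)"
  using st_eq_iff_order_isomorphic[OF assms, of "map x [n..<n + k]"]
  by (simp add: occurs_at_def length_perms[OF assms] del: upt_Suc)

lemma occurs_at_increasing_iff_le:
  "occurs_at [1..<k + 1] x n \<longleftrightarrow> (\<forall>a<k. \<forall>b<k. x (n + a) \<le> x (n + b) \<longleftrightarrow> a \<le> b)"
  by (subst occurs_at_iff_order_isomorphic[OF increasing_in_perms]) (auto simp del: upt_Suc)

text \<open>
  This local form, in terms of neighbours only, allows an occurrence to be extended by one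
  position to the left.
\<close>

lemma occurs_at_increasing_iff:
  "occurs_at [1..<k + 1] x n \<longleftrightarrow> (\<forall>a. a + 1 < k \<longrightarrow> x (n + a) < x (n + a + 1))"
proof
  assume "occurs_at [1..<k + 1] x n"
  then have le: "a < k \<Longrightarrow> b < k \<Longrightarrow> x (n + a) \<le> x (n + b) \<longleftrightarrow> a \<le> b" for a b
    unfolding occurs_at_increasing_iff_le by blast
  show "\<forall>a. a + 1 < k \<longrightarrow> x (n + a) < x (n + a + 1)"
  proof (intro allI impI)
    fix a assume "a + 1 < k"
    then show "x (n + a) < x (n + a + 1)" using le[of "a + 1" a] by (simp add: add.assoc)
  qed
next
  assume asc: "\<forall>a. a + 1 < k \<longrightarrow> x (n + a) < x (n + a + 1)"
  have less: "x (n + a) < x (n + b)" if "a < b" "b < k" for a b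
    using that
  proof (induction b)
    case (Suc b)
    then have "x (n + b) < x (n + Suc b)" using asc by simp
    moreover have "a = b \<or> x (n + a) < x (n + b)" using Suc by (auto simp: less_Suc_eq)
    ultimately show ?case by auto
  qed simp
  show "occurs_at [1..<k + 1] x n"
    unfolding occurs_at_increasing_iff_le
  proof (intro allI impI)
    fix a b assume "a < k" "b < k"
    then show "x (n + a) \<le> x (n + b) \<longleftrightarrow> a \<le> b"
      using less[of a b] less[of b a] by (cases a b rule: linorder_cases) auto
  qed
qed

lemma measurable_occurs_at:
  assumes "p \<in> perms k"
  shows "Measurable.pred (Pi\<^sub>M UNIV (\<lambda>_. borel)) (\<lambda>x. occurs_at p x n)"
proof -
  let ?S = "Pi\<^sub>M UNIV (\<lambda>_::nat. borel :: real measure)"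
  have component: "(\<lambda>x. x m) \<in> borel_measurable ?S" for m
    by (rule measurable_component_singleton) simp
  have le: "Measurable.pred ?S (\<lambda>x. x l \<le> x m)" for l m
    unfolding pred_def using component component by (rule borel_measurable_le)
  show ?thesis
    unfolding occurs_at_iff_order_isomorphic[OF assms]
    by (intro pred_intros_countable pred_intros_logic le) auto
qed

section \<open>The race between two patterns\<close>

lemma first_occurrence_less_iff:
  "first_occurrence p x < first_occurrence q x \<longleftrightarrow>
     (\<exists>n. occurs_at p x n \<and> (\<forall>m\<le>n. \<not> occurs_at q x m))"
proof
  assume "first_occurrence p x < first_occurrence q x"
  then obtain n where n: "occurs_at p x n" "enat n < first_occurrence q x"
    by (auto simp: first_occurrence_def[of p] INF_less_iff)
  have "n < m" if "occurs_at q x m" for m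
    using n(2) that INF_lower[of m "{n. occurs_at q x n}" enat]
    by (simp add: first_occurrence_def) (meson enat_ord_simps(2) order_less_le_trans)
  with n(1) show "\<exists>n. occurs_at p x n \<and> (\<forall>m\<le>n. \<not> occurs_at q x m)"
    by fastforce
next
  assume "\<exists>n. occurs_at p x n \<and> (\<forall>m\<le>n. \<not> occurs_at q x m)"
  then obtain n where n: "occurs_at p x n" "\<forall>m\<le>n. \<not> occurs_at q x m" by blast
  have "first_occurrence p x \<le> enat n"
    unfolding first_occurrence_def by (rule INF_lower) (simp add: n)
  also have "\<dots> < enat (Suc n)" by simp
  also have "\<dots> \<le> first_occurrence q x"
    unfolding first_occurrence_def by (rule INF_greatest) (use n in \<open>auto simp: Suc_le_eq not_le[symmetric]\<close>)
  finally show "first_occurrence p x < first_occurrence q x" .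
qed

definition wins_at :: "nat list \<Rightarrow> nat list \<Rightarrow> (nat \<Rightarrow> real) \<Rightarrow> nat \<Rightarrow> bool" where
  "wins_at p q x n \<longleftrightarrow>
     occurs_at p x n \<and> (\<forall>m<n. \<not> occurs_at p x m \<and> \<not> occurs_at q x m)"

lemma wins_at_unique: "wins_at p q x m \<Longrightarrow> wins_at p q x n \<Longrightarrow> m = n"
  unfolding wins_at_def by (metis linorder_neqE_nat)

lemma first_occurrence_less_iff_wins_at:
  assumes "length p = length q" "p \<noteq> q"
  shows "first_occurrence p x < first_occurrence q x \<longleftrightarrow> (\<exists>n. wins_at p q x n)"
proof
  assume "first_occurrence p x < first_occurrence q x"
  then obtain n where n: "occurs_at p x n" "\<forall>m\<le>n. \<not> occurs_at q x m"
    unfolding first_occurrence_less_iff by blast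
  define l where "l = (LEAST n. occurs_at p x n)"
  have "occurs_at p x l" unfolding l_def using n(1) by (rule LeastI)
  moreover have "l \<le> n" unfolding l_def using n(1) by (rule Least_le)
  moreover have "\<not> occurs_at p x m" if "m < l" for m
    using that unfolding l_def by (rule not_less_Least)
  ultimately have "wins_at p q x l"
    using n(2) unfolding wins_at_def by simp
  then show "\<exists>n. wins_at p q x n" ..
next
  assume "\<exists>n. wins_at p q x n"
  then obtain n where n: "wins_at p q x n" ..
  \<comment> \<open>A block has only one standardisation, so two different patterns of equal length
    cannot occur at the same position.\<close>
  have "\<not> occurs_at q x n"
    using n assms by (auto simp: wins_at_def occurs_at_def)
  with n show "first_occurrence p x < first_occurrence q x"
    unfolding first_occurrence_less_iff wins_at_def by (auto simp: le_less)
qed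

lemma measurable_wins_at:
  assumes "p \<in> perms k" "q \<in> perms k"
  shows "Measurable.pred (Pi\<^sub>M UNIV (\<lambda>_. borel)) (\<lambda>x. wins_at p q x n)"
proof -
  note [measurable] = measurable_occurs_at[OF assms(1)] measurable_occurs_at[OF assms(2)]
  show ?thesis unfolding wins_at_def by measurable
qed

section \<open>A pattern that is increasing except at its end\<close>

text \<open>
  The bounds on \<open>m\<close> admit exactly the blocks that end at position \<open>n\<close> or earlier. So this depends
  only on \<open>x 0, \<dots>, x n\<close>. The first clause is vacuous for \<open>n = 0\<close>.
\<close>

definition fresh_start :: "nat list \<Rightarrow> nat list \<Rightarrow> (nat \<Rightarrow> real) \<Rightarrow> nat \<Rightarrow> bool" where
  "fresh_start p q x n \<longleftrightarrow>
     (\<forall>m. n = Suc m \<longrightarrow> \<not> x m < x n) \<and>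
     (\<forall>m. m + length p \<le> n + 1 \<longrightarrow> \<not> occurs_at p x m) \<and>
     (\<forall>m. m + length q \<le> n + 1 \<longrightarrow> \<not> occurs_at q x m)"

lemma occurs_at_cong:
  assumes "\<And>m. m < n + length p \<Longrightarrow> x m = y m"
  shows "occurs_at p x n \<longleftrightarrow> occurs_at p y n"
proof -
  have "map x [n..<n + length p] = map y [n..<n + length p]"
    by (rule map_cong[OF refl], rule assms) simp
  then show ?thesis unfolding occurs_at_def by (simp only:)
qed

lemma fresh_start_cong:
  assumes "\<And>m. m \<le> n \<Longrightarrow> x m = y m"
  shows "fresh_start p q x n \<longleftrightarrow> fresh_start p q y n"
proof -
  have "occurs_at r x m \<longleftrightarrow> occurs_at r y m" if "m + length r \<le> n + 1" for r m
    using that by (intro occurs_at_cong assms) auto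
  moreover have "x m < x n \<longleftrightarrow> y m < y n" if "n = Suc m" for m
    using that by (simp add: assms)
  ultimately show ?thesis unfolding fresh_start_def by auto
qed

text \<open>
  That the entries before the last one increase controls overlaps of occurrences. That the first entry is 1 allows \<open>x n\<close> to stay
  in place when an occurrence at \<open>n\<close> is rearranged into an increasing one.
\<close>

locale almost_increasing_pattern =
  fixes k :: nat and p :: "nat list"
  assumes perm: "p \<in> perms k"
    and first: "p ! 0 = 1"
    and two_le: "2 \<le> k"
    and ascent: "\<And>a. a + 2 < k \<Longrightarrow> p ! a < p ! (a + 1)"
    and not_increasing: "p \<noteq> [1..<k + 1]"
begin

lemma occurs_at_ascent:
  assumes "occurs_at p x m \<or> occurs_at [1..<k + 1] x m" "a + 2 < k"
  shows "x (m + a) < x (m + a + 1)"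
  using assms(1)
proof
  assume "occurs_at p x m"
  moreover have "a + 1 < k" "a < k" using assms(2) by simp_all
  ultimately have "x (m + (a + 1)) \<le> x (m + a) \<longleftrightarrow> p ! (a + 1) \<le> p ! a"
    unfolding occurs_at_iff_order_isomorphic[OF perm] by blast
  then show ?thesis using ascent[OF assms(2)] by (simp add: add.assoc)
next
  assume "occurs_at [1..<k + 1] x m"
  then show ?thesis using assms(2) unfolding occurs_at_increasing_iff by simp
qed

text \<open>
  An ascent from \<open>n - 1\<close> to \<open>n\<close> would complete an increasing block at \<open>n - 1\<close>, hence an earlier
  occurrence. Without that ascent an earlier block that goes on beyond \<open>n\<close> cannot be an occurrence,
  because only the last step of either pattern may be a descent.
\<close>

lemma no_earlier_iff_fresh_start:
  assumes "occurs_at p x n \<or> occurs_at [1..<k + 1] x n"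
  shows "(\<forall>m<n. \<not> occurs_at p x m \<and> \<not> occurs_at [1..<k + 1] x m) \<longleftrightarrow>
    fresh_start p [1..<k + 1] x n"
proof
  have len: "length p = k" by (rule length_perms[OF perm])
  assume none: "\<forall>m<n. \<not> occurs_at p x m \<and> \<not> occurs_at [1..<k + 1] x m"
  have "\<not> x m < x n" if n: "n = Suc m" for m
  proof
    assume up: "x m < x n"
    have "occurs_at [1..<k + 1] x m"
      unfolding occurs_at_increasing_iff
    proof (intro allI impI)
      fix a assume a: "a + 1 < k"
      show "x (m + a) < x (m + a + 1)"
      proof (cases a)
        case 0
        then show ?thesis using up n by simp
      next
        case (Suc b)
        then show ?thesis using occurs_at_ascent[OF assms, of b] a n by simp
      qed
    qed
    then show False using none n by simp
  qed
  moreover have "m < n" if "m + k \<le> n + 1" for m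
    using that two_le by linarith
  ultimately show "fresh_start p [1..<k + 1] x n"
    using none len by (auto simp: fresh_start_def simp del: upt_Suc)
next
  have len: "length p = k" by (rule length_perms[OF perm])
  assume fresh: "fresh_start p [1..<k + 1] x n"
  show "\<forall>m<n. \<not> occurs_at p x m \<and> \<not> occurs_at [1..<k + 1] x m"
  proof (intro allI impI)
    fix m assume m: "m < n"
    show "\<not> occurs_at p x m \<and> \<not> occurs_at [1..<k + 1] x m"
    proof (cases "m + k \<le> n + 1")
      case True
      then show ?thesis using fresh len by (auto simp: fresh_start_def simp del: upt_Suc)
    next
      case False
      \<comment> \<open>The block at \<open>m\<close> goes beyond \<open>n\<close>, so the step from \<open>n - 1\<close> to \<open>n\<close> is not its last one.\<close>
      have "n = Suc (n - 1)" using m by simp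
      then have "\<not> x (n - 1) < x n" using fresh unfolding fresh_start_def by blast
      moreover have "m + (n - 1 - m) = n - 1" "m + (n - 1 - m) + 1 = n" "n - 1 - m + 2 < k"
        using m False by auto
      ultimately show ?thesis using occurs_at_ascent[of x m "n - 1 - m"] by metis
    qed
  qed
qed

text \<open>
  Reading an increasing block at \<open>n\<close> in the order given by \<open>p\<close> yields an occurrence of \<open>p\<close>.
  Entries of \<open>p\<close> count from 1 and offsets in a block from 0.
\<close>

definition rearrange :: "nat \<Rightarrow> nat \<Rightarrow> nat" where
  "rearrange n m = (if n \<le> m \<and> m < n + k then n + (p ! (m - n) - 1) else m)"

text \<open>
  Position \<open>n\<close> itself is fixed because \<open>p\<close> starts with 1; this is where \<open>i \<ge> 2\<close> enters.
\<close>

lemma rearrange_before: "m \<le> n \<Longrightarrow> rearrange n m = m"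
  using first by (auto simp: rearrange_def)

lemma inj_rearrange: "inj (rearrange n)"
proof (rule injI)
  have range: "n \<le> rearrange n m \<and> rearrange n m < n + k \<longleftrightarrow> n \<le> m \<and> m < n + k" for m
  proof (cases "n \<le> m \<and> m < n + k")
    case True
    then have "1 \<le> p ! (m - n)" "p ! (m - n) \<le> k"
      using nth_perms[OF perm, of "m - n"] by auto
    then show ?thesis using True by (simp add: rearrange_def) linarith
  qed (auto simp: rearrange_def)
  fix l m assume eq: "rearrange n l = rearrange n m"
  show "l = m"
  proof (cases "n \<le> m \<and> m < n + k")
    case False
    then have "\<not> (n \<le> l \<and> l < n + k)" using range[of l] range[of m] unfolding eq by blast
    then show ?thesis using eq False by (auto simp: rearrange_def)
  next
    case True
    then have l: "n \<le> l \<and> l < n + k" using range[of l] range[of m] unfolding eq by blast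
    then have "l - n < k" "m - n < k" using True by auto
    then have "1 \<le> p ! (l - n)" "1 \<le> p ! (m - n)" using nth_perms[OF perm] by blast+
    moreover have "p ! (l - n) - 1 = p ! (m - n) - 1"
      using eq l True by (simp add: rearrange_def)
    ultimately have "p ! (l - n) = p ! (m - n)" by linarith
    then have "l - n = m - n"
      using l True perm by (auto simp: nth_eq_iff_index_eq length_perms[OF perm] permutations_of_setD)
    then show ?thesis using l True by linarith
  qed
qed

lemma occurs_at_rearrange:
  "occurs_at p (\<lambda>m. x (rearrange n m)) n \<longleftrightarrow> occurs_at [1..<k + 1] x n"
proof -
  have image: "(\<lambda>a. p ! a - 1) ` {..<k} = {..<k}"
  proof -
    have "(\<lambda>a. p ! a - 1) ` {..<k} = (\<lambda>v. v - 1) ` set p"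
      unfolding set_conv_nth length_perms[OF perm] by auto
    also have "\<dots> = {..<k}"
      unfolding permutations_of_setD(1)[OF perm] image_Suc_lessThan[symmetric] image_image by simp
    finally show ?thesis .
  qed
  have "occurs_at [1..<k + 1] x n \<longleftrightarrow>
      (\<forall>a\<in>{..<k}. \<forall>b\<in>{..<k}. x (n + a) \<le> x (n + b) \<longleftrightarrow> a \<le> b)"
    unfolding occurs_at_increasing_iff_le by auto
  also have "\<dots> \<longleftrightarrow>
      (\<forall>a<k. \<forall>b<k. x (n + (p ! a - 1)) \<le> x (n + (p ! b - 1)) \<longleftrightarrow> p ! a - 1 \<le> p ! b - 1)"
    by (subst (1 2) image[symmetric]) auto
  also have "\<dots> \<longleftrightarrow> (\<forall>a<k. \<forall>b<k. x (rearrange n (n + a)) \<le> x (rearrange n (n + b)) \<longleftrightarrow> p ! a \<le> p ! b)"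
    using nth_perms[OF perm] by (auto simp: rearrange_def le_diff_iff)
  also have "\<dots> \<longleftrightarrow> occurs_at p (\<lambda>m. x (rearrange n m)) n"
    unfolding occurs_at_iff_order_isomorphic[OF perm] ..
  finally show ?thesis ..
qed

text \<open>
  The rearrangement turns one pattern into the other and leaves the common condition on
  \<open>x 0, \<dots>, x n\<close> untouched.
\<close>

lemma wins_at_rearrange:
  "wins_at p [1..<k + 1] (\<lambda>m. x (rearrange n m)) n \<longleftrightarrow> wins_at [1..<k + 1] p x n"
proof -
  have "wins_at p [1..<k + 1] (\<lambda>m. x (rearrange n m)) n \<longleftrightarrow>
      occurs_at p (\<lambda>m. x (rearrange n m)) n \<and>
      fresh_start p [1..<k + 1] (\<lambda>m. x (rearrange n m)) n"
    using no_earlier_iff_fresh_start unfolding wins_at_def by blast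
  also have "\<dots> \<longleftrightarrow> occurs_at [1..<k + 1] x n \<and> fresh_start p [1..<k + 1] x n"
    unfolding occurs_at_rearrange
    using fresh_start_cong[of n "\<lambda>m. x (rearrange n m)" x] by (simp add: rearrange_before)
  also have "\<dots> \<longleftrightarrow> wins_at [1..<k + 1] p x n"
    using no_earlier_iff_fresh_start unfolding wins_at_def by blast
  finally show ?thesis .
qed

end

section \<open>Exchangeability of independent identically distributed variables\<close>

lemma iid_continuous_random_variable:
  assumes "prob_space M" "iid_continuous M X"
  shows "X n \<in> borel_measurable M"
  using assms unfolding iid_continuous_def by (auto simp: prob_space.indep_vars_def2)

lemma measurable_sequence:
  assumes "prob_space M" "iid_continuous M X"
  shows "(\<lambda>\<omega> n. X (f n) \<omega>) \<in> M \<rightarrow>\<^sub>M Pi\<^sub>M UNIV (\<lambda>_. borel)"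
  using iid_continuous_random_variable[OF assms] by (intro measurable_PiM_single') auto

text \<open>
  The joint law of the sequence is the product of copies of one law, and such a product does not
  change when coordinates are selected injectively.
\<close>

lemma iid_reindex:
  assumes M: "prob_space M" "iid_continuous M X" and f: "inj f"
    and Q [measurable]: "Measurable.pred (Pi\<^sub>M UNIV (\<lambda>_. borel)) Q"
  shows "measure M {\<omega> \<in> space M. Q (\<lambda>n. X (f n) \<omega>)} = measure M {\<omega> \<in> space M. Q (\<lambda>n. X n \<omega>)}"
proof -
  interpret prob_space M by fact
  note [measurable] = iid_continuous_random_variable[OF M]
  let ?S = "Pi\<^sub>M UNIV (\<lambda>_::nat. borel :: real measure)"
  let ?D = "distr M borel (X 0)"
  let ?L = "Pi\<^sub>M UNIV (\<lambda>_::nat. ?D)"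
  have D: "distr M borel (X n) = ?D" for n
    using M(2) unfolding iid_continuous_def by blast
  have "distr M ?S (\<lambda>\<omega>. \<lambda>n\<in>UNIV. X n \<omega>) = Pi\<^sub>M UNIV (\<lambda>n. distr M borel (X n))"
    using M(2) unfolding iid_continuous_def
    by (subst indep_vars_iff_distr_eq_PiM[symmetric]) auto
  also have "\<dots> = ?L" by (intro PiM_cong refl D)
  finally have law: "distr M ?S (\<lambda>\<omega> n. X n \<omega>) = ?L" by (simp add: restrict_def)
  have sets_L: "sets ?L = sets ?S" by (intro sets_PiM_cong) auto
  have shift [measurable]: "(\<lambda>x n. x (f n)) \<in> ?S \<rightarrow>\<^sub>M ?S"
    by (intro measurable_PiM_single') auto
  have "distr ?L ?L (\<lambda>x. \<lambda>n\<in>UNIV. x (f n)) = ?L"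
    using f by (intro distr_PiM_reindex prob_space_distr) auto
  then have "distr ?L ?S (\<lambda>x. \<lambda>n\<in>UNIV. x (f n)) = ?L"
    using distr_cong[OF refl sets_L refl] by metis
  then have "distr ?L ?S (\<lambda>x n. x (f n)) = ?L"
    by (simp only: restrict_UNIV)
  then have law_f: "distr M ?S (\<lambda>\<omega> n. X (f n) \<omega>) = ?L"
    unfolding law[symmetric]
    by (subst (asm) distr_distr) (auto simp: comp_def intro: measurable_sequence[OF M])
  have "measure M {\<omega> \<in> space M. Q (\<lambda>n. X (g n) \<omega>)} =
      measure (distr M ?S (\<lambda>\<omega> n. X (g n) \<omega>)) {x \<in> space ?S. Q x}" for g
  proof -
    have "{x \<in> space ?S. Q x} \<in> sets ?S" by measurable
    then show ?thesis
      by (subst measure_distr[OF measurable_sequence[OF M]])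
         (auto simp: space_PiM intro!: arg_cong[where f = "measure M"])
  qed
  from this[of f] this[of "\<lambda>n. n"] show ?thesis unfolding law law_f by simp
qed

section \<open>Some increasing block occurs almost surely\<close>

lemma continuous_cdf_quantile:
  assumes "real_distribution D" "continuous_on UNIV (cdf D)" "0 < t" "t < 1"
  shows "\<exists>u. cdf D u = t"
proof -
  interpret real_distribution D by fact
  obtain v where v: "cdf D v < t"
    using order_tendstoD(2)[OF cdf_lim_at_bot assms(3)] eventually_happens'[OF trivial_limit_at_bot_linorder]
    by blast
  obtain w where w: "t < cdf D w"
    using order_tendstoD(1)[OF cdf_lim_at_top_prob assms(4)] eventually_happens'[OF trivial_limit_at_top_linorder]
    by blast
  have "v \<le> w" using v w cdf_nondecreasing[of w v] by linarith
  then show ?thesis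
    using IVT'[of "cdf D" v t w] v w continuous_on_subset[OF assms(2)] by fastforce
qed

text \<open>
  The end points are quantiles. The levels \<open>1 / (k + 2), \<dots>, (k + 1) / (k + 2)\<close> stay strictly between
  0 and 1, so that all end points are finite.
\<close>

lemma equiprobable_intervals:
  fixes k :: nat
  assumes "real_distribution D" "continuous_on UNIV (cdf D)"
  shows "\<exists>u :: nat \<Rightarrow> real. \<forall>j<k. measure D {u j<..u (j + 1)} = 1 / (k + 2)"
proof -
  interpret real_distribution D by fact
  define t where "t j = (real j + 1) / (real k + 2)" for j :: nat
  have t_Suc: "t (j + 1) - t j = 1 / (k + 2)" for j
    by (simp add: t_def diff_divide_distrib[symmetric] add.commute)
  have "\<exists>u. cdf D u = t j" if "j \<le> k" for j
    using that by (intro continuous_cdf_quantile assms) (auto simp: t_def)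
  then obtain u where u: "\<And>j. j \<le> k \<Longrightarrow> cdf D (u j) = t j" by metis
  have "measure D {u j<..u (j + 1)} = 1 / (k + 2)" if "j < k" for j
  proof -
    have diff: "cdf D (u (j + 1)) - cdf D (u j) = 1 / (k + 2)"
      using that t_Suc[of j] by (simp add: u)
    have "u j < u (j + 1)"
    proof (rule ccontr)
      assume "\<not> u j < u (j + 1)"
      then have "cdf D (u (j + 1)) \<le> cdf D (u j)" by (intro cdf_nondecreasing) simp
      moreover have "0 < 1 / real (k + 2)" by simp
      ultimately show False using diff by linarith
    qed
    then show ?thesis using cdf_diff_eq diff by simp
  qed
  then show ?thesis by blast
qed

text \<open>
  A block whose entries lie one after the other in the intervals of \<open>equiprobable_intervals\<close> is
  increasing. Disjoint blocks do this independently with the fixed probability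
  \<open>(1 / (k + 2)) ^ k\<close>, so the probability that none of the first \<open>N\<close> blocks does it tends to 0.
\<close>

lemma increasing_occurs_almost_surely:
  assumes M: "prob_space M" "iid_continuous M X" and k: "0 < k"
  shows "measure M {\<omega> \<in> space M. \<exists>n. occurs_at [1..<k + 1] (\<lambda>n. X n \<omega>) n} = 1"
proof -
  interpret prob_space M by fact
  note rv [measurable] = iid_continuous_random_variable[OF M]
  let ?D = "distr M borel (X 0)"
  have D: "distr M borel (X n) = ?D" for n
    using M(2) unfolding iid_continuous_def by blast
  have "continuous_on UNIV (cdf ?D)" using M(2) unfolding iid_continuous_def by blast
  then obtain u where u: "\<And>j. j < k \<Longrightarrow> measure ?D {u j<..u (j + 1)} = 1 / (k + 2)"
    using equiprobable_intervals[OF real_distribution_distr] rv by metis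
  define I where "I j = {u j<..u (j + 1)}" for j
  have prob_I: "prob (X n -` I j \<inter> space M) = 1 / (k + 2)" if "j < k" for n j
  proof -
    have "prob (X n -` I j \<inter> space M) = measure (distr M borel (X n)) (I j)"
      by (subst measure_distr) (auto simp: I_def)
    also have "\<dots> = 1 / (k + 2)"
      unfolding D[of n] I_def using that by (rule u)
    finally show ?thesis .
  qed
  have indep: "indep_vars (\<lambda>_. borel) X UNIV" using M(2) unfolding iid_continuous_def by blast
  \<comment> \<open>\<open>K b\<close> holds the positions of the \<open>b\<close>-th block, and \<open>A b\<close> says that it misses the intervals.\<close>
  define K where "K b = {b * k..<b * k + k}" for b
  define Y where "Y b \<omega> = restrict (\<lambda>i. X i \<omega>) (K b)" for b \<omega>
  define A where "A b = {f \<in> space (Pi\<^sub>M (K b) (\<lambda>_. borel)). \<not> (\<forall>j<k. f (b * k + j) \<in> I j)}" for b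
  have "disjoint_family_on K UNIV"
    unfolding disjoint_family_on_def K_def
  proof (intro ballI impI equals0I)
    fix b c m assume "b \<noteq> c" and m: "m \<in> {b * k..<b * k + k} \<inter> {c * k..<c * k + k}"
    have "m div k = b" "m div k = c"
      using m by (auto intro!: div_nat_eqI simp: algebra_simps)
    then show False using \<open>b \<noteq> c\<close> by simp
  qed
  then have indep_Y: "indep_vars (\<lambda>b. Pi\<^sub>M (K b) (\<lambda>_. borel)) Y UNIV"
    unfolding Y_def by (intro indep_vars_restrict[OF indep]) auto
  have A: "A b \<in> sets (Pi\<^sub>M (K b) (\<lambda>_. borel))" for b
  proof -
    have [measurable]: "(\<lambda>f. f (b * k + j)) \<in> borel_measurable (Pi\<^sub>M (K b) (\<lambda>_. borel))" if "j < k" for j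
      using that by (intro measurable_component_singleton) (simp add: K_def)
    have [measurable]: "I j \<in> sets borel" for j by (simp add: I_def)
    have "(\<Inter>j\<in>{..<k}. {f \<in> space (Pi\<^sub>M (K b) (\<lambda>_. borel)). f (b * k + j) \<in> I j})
        \<in> sets (Pi\<^sub>M (K b) (\<lambda>_. borel))"
      using k by (intro sets.finite_INT) auto
    moreover have "A b = space (Pi\<^sub>M (K b) (\<lambda>_. borel)) -
        (\<Inter>j\<in>{..<k}. {f \<in> space (Pi\<^sub>M (K b) (\<lambda>_. borel)). f (b * k + j) \<in> I j})"
      using k by (auto simp: A_def)
    ultimately show ?thesis by auto
  qed
  have Y_A: "Y b -` A b \<inter> space M = space M - (\<Inter>j\<in>{..<k}. X (b * k + j) -` I j \<inter> space M)" for b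
    using k by (auto simp: Y_def A_def K_def space_PiM)
  have prob_A: "prob (Y b -` A b \<inter> space M) = 1 - (1 / (k + 2)) ^ k" for b
  proof -
    have "prob (\<Inter>j\<in>{..<k}. X (b * k + j) -` I j \<inter> space M) =
        prob (\<Inter>m\<in>K b. X m -` I (m - b * k) \<inter> space M)"
    proof -
      have "K b = (+) (b * k) ` {..<k}" by (simp add: K_def image_add_atLeastLessThan lessThan_atLeast0 add.commute)
      then show ?thesis by simp
    qed
    also have "\<dots> = (\<Prod>m\<in>K b. prob (X m -` I (m - b * k) \<inter> space M))"
      using k by (intro indep_varsD[OF indep]) (auto simp: K_def I_def)
    also have "\<dots> = (\<Prod>m\<in>K b. 1 / (k + 2))"
      by (intro prod.cong refl prob_I) (auto simp: K_def)
    also have "\<dots> = (1 / (k + 2)) ^ k" by (simp add: K_def)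
    finally show ?thesis
      unfolding Y_A using k by (subst prob_compl) (auto simp: I_def)
  qed
  let ?occ = "{\<omega> \<in> space M. \<exists>n. occurs_at [1..<k + 1] (\<lambda>n. X n \<omega>) n}"
  have occ: "?occ \<in> sets M"
  proof -
    note [measurable] = measurable_occurs_at[OF increasing_in_perms[of k]] measurable_sequence[OF M]
    show ?thesis by measurable
  qed
  have avoid: "space M - ?occ \<subseteq> Y b -` A b \<inter> space M" for b
  proof
    fix \<omega> assume \<omega>: "\<omega> \<in> space M - ?occ"
    then have "\<not> occurs_at [1..<k + 1] (\<lambda>n. X n \<omega>) (b * k)" by auto
    then obtain a where a: "a + 1 < k" "\<not> X (b * k + a) \<omega> < X (b * k + a + 1) \<omega>"
      unfolding occurs_at_increasing_iff by auto
    then have "\<not> (X (b * k + a) \<omega> \<in> I a \<and> X (b * k + (a + 1)) \<omega> \<in> I (a + 1))"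
      by (auto simp: I_def add.assoc)
    then have "\<not> (\<forall>j<k. X (b * k + j) \<omega> \<in> I j)" using a(1) by (meson add_lessD1)
    then show "\<omega> \<in> Y b -` A b \<inter> space M" using \<omega> unfolding Y_A by auto
  qed
  have "prob (space M - ?occ) \<le> (1 - (1 / (k + 2)) ^ k) ^ Suc N" for N
  proof -
    have "prob (space M - ?occ) \<le> prob (\<Inter>b\<in>{..N}. Y b -` A b \<inter> space M)"
    proof (rule finite_measure_mono)
      show "(\<Inter>b\<in>{..N}. Y b -` A b \<inter> space M) \<in> events"
        using indep_Y A by (intro sets.finite_INT measurable_sets) (auto simp: indep_vars_def2)
    qed (use avoid in blast)
    also have "\<dots> = (\<Prod>b\<in>{..N}. prob (Y b -` A b \<inter> space M))"
      using A by (intro indep_varsD[OF indep_Y]) auto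
    finally show ?thesis by (simp add: prob_A)
  qed
  moreover have "(\<lambda>N. (1 - (1 / (real k + 2)) ^ k) ^ Suc N) \<longlonglongrightarrow> 0"
  proof -
    have "0 < (1 / (real k + 2)) ^ k" "(1 / (real k + 2)) ^ k \<le> 1"
      by (auto intro!: power_le_one)
    then show ?thesis by (intro LIMSEQ_Suc LIMSEQ_realpow_zero) auto
  qed
  ultimately have "prob (space M - ?occ) \<le> 0"
    by (intro LIMSEQ_le_const) (auto simp: add.commute)
  then have "1 \<le> prob ?occ" using prob_compl[OF occ] by linarith
  then show ?thesis using prob_le_1 by (rule antisym[rotated])
qed

section \<open>Both patterns are equally likely to come first\<close>

lemma prob_before_eq_sum_wins_at:
  assumes M: "prob_space M" "iid_continuous M X"
    and pq: "p \<in> perms k" "q \<in> perms k" "p \<noteq> q"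
  shows "prob_before M X p q = (\<Sum>n. measure M {\<omega> \<in> space M. wins_at p q (\<lambda>n. X n \<omega>) n})"
proof -
  interpret prob_space M by fact
  note [measurable] = measurable_wins_at[OF pq(1,2)] measurable_sequence[OF M]
  let ?W = "\<lambda>n. {\<omega> \<in> space M. wins_at p q (\<lambda>n. X n \<omega>) n}"
  have "prob_before M X p q = prob (\<Union>n. ?W n)"
    unfolding prob_before_def
    by (intro arg_cong[where f = prob])
       (auto simp: first_occurrence_less_iff_wins_at length_perms[OF pq(1)] length_perms[OF pq(2)] pq(3))
  also have "\<dots> = (\<Sum>n. prob (?W n))"
  proof (rule sums_unique[OF measure_UNION])
    show "range ?W \<subseteq> events" by auto
    show "disjoint_family ?W"
      using wins_at_unique by (fastforce simp: disjoint_family_on_def)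
  qed (simp add: emeasure_eq_measure)
  finally show ?thesis .
qed

context almost_increasing_pattern
begin

lemma prob_before_sym:
  assumes M: "prob_space M" "iid_continuous M X"
  shows "prob_before M X p [1..<k + 1] = prob_before M X [1..<k + 1] p"
proof -
  note inc = increasing_in_perms[of k]
  have "measure M {\<omega> \<in> space M. wins_at p [1..<k + 1] (\<lambda>n. X n \<omega>) n} =
      measure M {\<omega> \<in> space M. wins_at [1..<k + 1] p (\<lambda>n. X n \<omega>) n}" for n
    using iid_reindex[OF M inj_rearrange[of n] measurable_wins_at[OF perm inc, of n]]
    unfolding wins_at_rearrange[of "\<lambda>m. X m \<omega>" n for \<omega>] by (rule sym)
  then show ?thesis
    using prob_before_eq_sum_wins_at[OF M perm inc not_increasing]
      prob_before_eq_sum_wins_at[OF M inc perm not_increasing[symmetric]] by simp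
qed

text \<open>
  Once the increasing pattern occurs, the earliest position at which either pattern occurs decides
  the race.
\<close>

lemma prob_before_total:
  assumes M: "prob_space M" "iid_continuous M X"
  shows "prob_before M X p [1..<k + 1] + prob_before M X [1..<k + 1] p = 1"
proof -
  interpret prob_space M by fact
  let ?s = "[1..<k + 1]"
  note inc = increasing_in_perms[of k]
  note [measurable] = measurable_occurs_at[OF perm] measurable_occurs_at[OF inc] measurable_sequence[OF M]
  let ?first = "\<lambda>q \<omega>. first_occurrence q (\<lambda>n. X n \<omega>)"
  let ?P = "{\<omega> \<in> space M. ?first p \<omega> < ?first ?s \<omega>}"
  let ?S = "{\<omega> \<in> space M. ?first ?s \<omega> < ?first p \<omega>}"
  have sets: "?P \<in> events" "?S \<in> events"
    unfolding first_occurrence_less_iff by measurable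
  have "{\<omega> \<in> space M. \<exists>n. occurs_at ?s (\<lambda>n. X n \<omega>) n} \<subseteq> ?P \<union> ?S"
  proof
    fix \<omega> assume "\<omega> \<in> {\<omega> \<in> space M. \<exists>n. occurs_at ?s (\<lambda>n. X n \<omega>) n}"
    then obtain n where \<omega>: "\<omega> \<in> space M" and n: "occurs_at ?s (\<lambda>n. X n \<omega>) n" by blast
    have neq: "\<not> (occurs_at p x m \<and> occurs_at ?s x m)" for x m
      using not_increasing length_perms[OF perm] by (auto simp: occurs_at_def simp del: upt_Suc)
    define m where "m = (LEAST m. occurs_at p (\<lambda>n. X n \<omega>) m \<or> occurs_at ?s (\<lambda>n. X n \<omega>) m)"
    have m: "occurs_at p (\<lambda>n. X n \<omega>) m \<or> occurs_at ?s (\<lambda>n. X n \<omega>) m"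
      unfolding m_def using n by (rule LeastI[OF disjI2])
    have "\<not> occurs_at p (\<lambda>n. X n \<omega>) l \<and> \<not> occurs_at ?s (\<lambda>n. X n \<omega>) l" if "l < m" for l
      using not_less_Least that unfolding m_def by blast
    then have "?first p \<omega> < ?first ?s \<omega> \<or> ?first ?s \<omega> < ?first p \<omega>"
      unfolding first_occurrence_less_iff using m neq by (metis le_neq_implies_less)
    then show "\<omega> \<in> ?P \<union> ?S" using \<omega> by blast
  qed
  then have "prob {\<omega> \<in> space M. \<exists>n. occurs_at ?s (\<lambda>n. X n \<omega>) n} \<le> prob (?P \<union> ?S)"
    using sets by (intro finite_measure_mono) auto
  then have "1 \<le> prob (?P \<union> ?S)"
    using increasing_occurs_almost_surely[OF M, of k] two_le by linarith
  then have "prob (?P \<union> ?S) = 1" using prob_le_1 by (rule antisym[rotated])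
  moreover have "?P \<inter> ?S = {}" using less_asym by blast
  then have "prob (?P \<union> ?S) = prob ?P + prob ?S"
    by (rule finite_measure_Union[OF sets])
  ultimately show ?thesis unfolding prob_before_def by linarith
qed

lemma tied_pair_increasing:
  assumes "prob_space M" "iid_continuous M X"
  shows "tied_pair M X k [1..<k + 1] p"
proof -
  have "prob_before M X p [1..<k + 1] = 1 / 2" "prob_before M X [1..<k + 1] p = 1 / 2"
    using prob_before_sym[OF assms] prob_before_total[OF assms] by linarith+
  then show ?thesis
    unfolding tied_pair_def using perm increasing_in_perms not_increasing by blast
qed

end

lemma almost_increasing_pattern_move_to_end:
  assumes "2 \<le> i" "i \<le> k - 1"
  shows "almost_increasing_pattern k ([1..<i] @ [i + 1..<k + 1] @ [i])"
proof
  let ?p = "[1..<i] @ [i + 1..<k + 1] @ [i]"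
  show "?p \<in> perms k" using assms by (auto simp: permutations_of_set_def)
  show "?p ! 0 = 1" using assms by (simp add: nth_append)
  show "2 \<le> k" using assms by simp
  show "?p ! a < ?p ! (a + 1)" if "a + 2 < k" for a
    using that assms by (auto simp: nth_append simp del: upt_Suc)
  have "last [1..<k + 1] = k" using assms by (subst last_upt) auto
  then have "last ?p \<noteq> last [1..<k + 1]" using assms by (simp del: upt_Suc)
  then show "?p \<noteq> [1..<k + 1]" by metis
qed

theorem theorem3p9:
  fixes M :: "'a measure" and X :: "nat \<Rightarrow> 'a \<Rightarrow> real" and i k :: nat
  assumes "prob_space M"
    and "iid_continuous M X"
    and "2 \<le> i" and "i \<le> k - 1"
  shows "tied_pair M X k [1..<k + 1] ([1..<i] @ [i + 1..<k + 1] @ [i])"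
  by (rule almost_increasing_pattern.tied_pair_increasing
      [OF almost_increasing_pattern_move_to_end[OF assms(3,4)] assms(1,2)])

end
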